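(* For each integer $k \geq 3$ there exists a $k$-colourable weakly chordal graph $G_k$ such that the reconfiguration graph $R_{k+1}(G_k)$ is disconnected.
   Context: All graphs are finite and simple. For a non-negative integer $k$, a $k$-colouring of a graph $G$ is a map $f: V(G) \to \{1,\dots,k\}$ with $f(u) \neq f(v)$ for every edge $uv$. The reconfiguration graph $R_k(G)$ has as vertex set all $k$-colourings of $G$, two colourings being adjacent if they differ on exactly one vertex of $G$. A hole is an induced cycle of length at least $5$, and an antihole is an induced subgraph whose complement is a cycle of length at least $5$. A graph is weakly chordal if it contains no hole and no antihole. *)

theory Defs
  imports "Graph_Theory.Digraph_Isomorphism" "HOL-Library.FuncSet"
begin

(* Finite simple graphs are the library's pair_graph structures: a finite vertex set with a
   symmetric irreflexive arc relation, so an edge uv is represented by the arcs (u,v) and (v,u). *)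

definition cycle_graph :: "nat \<Rightarrow> nat pair_pre_digraph" where
  "cycle_graph n = \<lparr> pverts = {0..<n},
     parcs = {(i, j). i < n \<and> j < n \<and> (j = Suc i mod n \<or> i = Suc j mod n)} \<rparr>"

definition complement_graph :: "'a pair_pre_digraph \<Rightarrow> 'a pair_pre_digraph" where
  "complement_graph G = \<lparr> pverts = pverts G,
     parcs = {(u, v). u \<in> pverts G \<and> v \<in> pverts G \<and> u \<noteq> v \<and> (u, v) \<notin> parcs G} \<rparr>"

definition is_hole :: "'a pair_pre_digraph \<Rightarrow> 'a pair_pre_digraph \<Rightarrow> bool" where
  "is_hole H G \<longleftrightarrow> induced_subgraph (with_proj H) (with_proj G) \<and>
     (\<exists>n\<ge>5. digraph_iso (with_proj H) (with_proj (cycle_graph n)))"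

definition is_antihole :: "'a pair_pre_digraph \<Rightarrow> 'a pair_pre_digraph \<Rightarrow> bool" where
  "is_antihole H G \<longleftrightarrow> induced_subgraph (with_proj H) (with_proj G) \<and>
     (\<exists>n\<ge>5. digraph_iso (with_proj (complement_graph H)) (with_proj (cycle_graph n)))"

definition weakly_chordal :: "'a pair_pre_digraph \<Rightarrow> bool" where
  "weakly_chordal G \<longleftrightarrow> \<not> (\<exists>H. is_hole H G) \<and> \<not> (\<exists>H. is_antihole H G)"

(* Extensionality of PiE makes a colouring a map on the vertex set proper: two colourings that
   agree on all vertices are equal. *)
definition colourings :: "nat \<Rightarrow> 'a pair_pre_digraph \<Rightarrow> ('a \<Rightarrow> nat) set" where
  "colourings k G = {f \<in> pverts G \<rightarrow>\<^sub>E {1..k}. \<forall>(u, v) \<in> parcs G. f u \<noteq> f v}"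

definition colourable :: "nat \<Rightarrow> 'a pair_pre_digraph \<Rightarrow> bool" where
  "colourable k G \<longleftrightarrow> colourings k G \<noteq> {}"

definition reconfiguration_graph ::
    "nat \<Rightarrow> 'a pair_pre_digraph \<Rightarrow> ('a \<Rightarrow> nat) pair_pre_digraph" where
  "reconfiguration_graph k G = \<lparr> pverts = colourings k G,
     parcs = {(f, g). f \<in> colourings k G \<and> g \<in> colourings k G \<and>
                      (\<exists>!v. v \<in> pverts G \<and> f v \<noteq> g v)} \<rparr>"

lemma pair_graph_cycle_graph:
  assumes "n \<ge> 3"
  shows "pair_graph (cycle_graph n)"
proof -
  have fin: "finite (parcs (cycle_graph n))"
    by (rule finite_subset[of _ "{0..<n} \<times> {0..<n}"]) (auto simp: cycle_graph_def)
  have loop: "Suc i mod n \<noteq> i" if "i < n" for i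
    using that assms by (cases "Suc i = n") auto
  show ?thesis
    by unfold_locales
      (use fin in \<open>auto simp: cycle_graph_def symmetric_def sym_def dest: loop\<close>)
qed

lemma pair_graph_reconfiguration_graph:
  assumes "pair_graph G"
  shows "pair_graph (reconfiguration_graph k G)"
proof -
  interpret pair_graph G by fact
  have fin: "finite (colourings k G)"
    by (rule finite_subset[of _ "pverts G \<rightarrow>\<^sub>E {1..k}"])
      (auto simp: colourings_def intro: finite_PiE pair_finite_verts)
  have fin2: "finite (parcs (reconfiguration_graph k G))"
    by (rule finite_subset[of _ "colourings k G \<times> colourings k G"])
      (auto simp: reconfiguration_graph_def fin)
  have "sym (parcs (reconfiguration_graph k G))"
    by (rule symI) (auto simp: reconfiguration_graph_def eq_commute)
  with fin fin2 show ?thesis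
    by unfold_locales (auto simp: reconfiguration_graph_def symmetric_def)
qed

(* The library counts the graph without vertices as not connected. The reconfiguration graph of a
   k-colourable graph on k + 1 colours has a vertex, so this convention does not matter for it. *)
lemma reconfiguration_graph_nonempty:
  assumes "colourable k G"
  shows "pverts (reconfiguration_graph (k + 1) G) \<noteq> {}"
proof -
  have "colourings k G \<subseteq> colourings (k + 1) G"
    by (force simp: colourings_def PiE_iff)
  with assms show ?thesis
    by (auto simp: colourable_def reconfiguration_graph_def)
qed

end

theory Submission
  imports Defs
begin

text \<open>
  The witness has vertices \<open>a\<^sub>i\<close> and \<open>c\<^sub>i\<close> for \<open>i \<le> k\<close>. The \<open>a\<^sub>i\<close> are independent, \<open>a\<^sub>i\<close> is
  joined to every \<open>c\<^sub>j\<close> with \<open>j \<noteq> i\<close>, and the \<open>c\<^sub>i\<close> induce a complete graph minus the matching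
  \<open>c\<^sub>0c\<^sub>1, c\<^sub>2c\<^sub>3, \<dots>\<close>. Giving the \<open>a\<^sub>i\<close> one colour and each matched pair another uses at most
  \<open>k\<close> colours. Giving \<open>a\<^sub>i\<close> and \<open>c\<^sub>i\<close> the colour \<open>i\<close> uses \<open>k + 1\<close> colours, and every vertex then
  sees all the colours but its own, so this colouring is an isolated vertex of the
  reconfiguration graph.

  The vertex \<open>c\<^sub>i\<close> has only two non-neighbours, namely \<open>a\<^sub>i\<close> and its matching partner. In a hole or
  antihole all degrees, respectively co-degrees, are 2 and there are at least 5 vertices. Hence if
  \<open>c\<^sub>i\<close> lies in it, so do both its non-neighbours, and therefore the whole block of four vertices
  formed by a matched pair and the corresponding \<open>a\<close>'s. Degree counting then rules this out.
\<close>

section \<open>Degrees in holes and antiholes\<close>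

text \<open>An isomorphism preserves out-degrees, and in the cycle the neighbours of
  \<open>i\<close> are its cyclic successor and its predecessor \<open>p\<close>, which differ since
  \<open>n \<ge> 3\<close>.\<close>

lemma digraph_iso_cycle_graph:
  assumes iso: "digraph_iso (with_proj H) (with_proj (cycle_graph n))" and n: "n \<ge> 3"
  shows "card (pverts H) = n"
    and "v \<in> pverts H \<Longrightarrow> card {w \<in> pverts H. (v, w) \<in> parcs H} = 2"
proof -
  obtain h where h: "pre_digraph.digraph_isomorphism (with_proj H) h"
    and eq: "with_proj (cycle_graph n) = app_iso h (with_proj H)"
    using iso by (auto simp: digraph_iso_def)
  interpret wf_digraph "with_proj H"
    using h by (simp add: pre_digraph.digraph_isomorphism_def)
  have img: "iso_verts h ` pverts H = {0..<n}"
    using arg_cong[OF eq, of verts] by (simp add: cycle_graph_def)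
  show "card (pverts H) = n"
    using card_image[OF digraph_isomorphism_inj_on_verts[OF h]] img by simp
  show "card {w \<in> pverts H. (v, w) \<in> parcs H} = 2" if v: "v \<in> pverts H"
  proof -
    define i where "i = iso_verts h v"
    have i: "i < n"
      using v img by (auto simp: i_def)
    define p where "p = (if i = 0 then n - 1 else i - 1)"
    have pred: "i = Suc j mod n \<longleftrightarrow> j = p" if "j < n" for j
      using that i n by (cases "Suc j = n") (auto simp: p_def)
    have "p < n"
      using i by (auto simp: p_def)
    have "out_arcs (with_proj (cycle_graph n)) i =
        Pair i ` {j. j < n \<and> (j = Suc i mod n \<or> i = Suc j mod n)}"
      using i by (auto simp: out_arcs_def cycle_graph_def)
    also have "{j. j < n \<and> (j = Suc i mod n \<or> i = Suc j mod n)} = {Suc i mod n, p}"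
      using pred \<open>p < n\<close> n by auto
    finally have "out_arcs (with_proj (cycle_graph n)) i = {(i, Suc i mod n), (i, p)}"
      by simp
    moreover have "Suc i mod n \<noteq> p"
      using i n by (cases "Suc i = n") (auto simp: p_def)
    ultimately have "out_degree (with_proj (cycle_graph n)) i = 2"
      by (simp add: out_degree_def)
    then have "out_degree (with_proj H) v = 2"
      using out_degree_app_iso_eq[OF h, of v] v by (simp add: eq i_def)
    moreover have "out_arcs (with_proj H) v = Pair v ` {w \<in> pverts H. (v, w) \<in> parcs H}"
      using wf_digraph_axioms by (auto simp: wf_digraph_def out_arcs_def image_iff)
    ultimately show ?thesis
      by (simp add: out_degree_def card_image inj_on_def)
  qed
qed

lemma is_hole_two_regular:
  assumes "is_hole H G"
  defines "S \<equiv> pverts H"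
  shows "S \<subseteq> pverts G" "5 \<le> card S"
    and "v \<in> S \<Longrightarrow> card {w \<in> S. (v, w) \<in> parcs G} = 2"
proof -
  obtain n where n: "n \<ge> 5" "digraph_iso (with_proj H) (with_proj (cycle_graph n))"
    using assms(1) by (auto simp: is_hole_def)
  have ind: "induced_subgraph (with_proj H) (with_proj G)"
    using assms(1) by (simp add: is_hole_def)
  then show "S \<subseteq> pverts G"
    by (auto simp: S_def induced_subgraph_def subgraph_def)
  show "5 \<le> card S"
    using n digraph_iso_cycle_graph(1)[OF n(2)] by (simp add: S_def)
  have "{w \<in> S. (v, w) \<in> parcs G} = {w \<in> S. (v, w) \<in> parcs H}" if "v \<in> S"
    using ind that by (auto simp: S_def induced_subgraph_def)
  then show "card {w \<in> S. (v, w) \<in> parcs G} = 2" if "v \<in> S"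
    using n digraph_iso_cycle_graph(2)[OF n(2), of v] that by (simp add: S_def)
qed

lemma is_antihole_two_regular:
  assumes "is_antihole H G"
  defines "S \<equiv> pverts H"
  shows "S \<subseteq> pverts G" "5 \<le> card S"
    and "v \<in> S \<Longrightarrow> card {w \<in> S. w \<noteq> v \<and> (v, w) \<notin> parcs G} = 2"
proof -
  obtain n where n: "n \<ge> 5"
    "digraph_iso (with_proj (complement_graph H)) (with_proj (cycle_graph n))"
    using assms(1) by (auto simp: is_antihole_def)
  have ind: "induced_subgraph (with_proj H) (with_proj G)"
    using assms(1) by (simp add: is_antihole_def)
  then show "S \<subseteq> pverts G"
    by (auto simp: S_def induced_subgraph_def subgraph_def)
  have verts: "pverts (complement_graph H) = S"
    by (simp add: complement_graph_def S_def)
  show "5 \<le> card S"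
    using n digraph_iso_cycle_graph(1)[OF n(2)] verts by simp
  have "{w \<in> S. w \<noteq> v \<and> (v, w) \<notin> parcs G} = {w \<in> S. (v, w) \<in> parcs (complement_graph H)}"
    if "v \<in> S"
    using ind that by (auto simp: S_def induced_subgraph_def complement_graph_def)
  then show "card {w \<in> S. w \<noteq> v \<and> (v, w) \<notin> parcs G} = 2" if "v \<in> S"
    using n digraph_iso_cycle_graph(2)[OF n(2), of v] that verts by simp
qed

section \<open>Frozen colourings\<close>

text \<open>Recolouring \<open>v\<close> with \<open>c\<close> always clashes with a neighbour
  already coloured \<open>c\<close>, so \<open>f\<close> is isolated; \<open>g\<close> is a second
  vertex that \<open>f\<close> would have to reach.\<close>

lemma frozen_colouring_imp_not_connected:
  assumes f: "f \<in> colourings k G" and g: "g \<in> colourings k G" and "f \<noteq> g"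
    and frozen: "\<And>v c. v \<in> pverts G \<Longrightarrow> c \<in> {1..k} \<Longrightarrow> c \<noteq> f v \<Longrightarrow>
                   \<exists>w \<in> pverts G. (v, w) \<in> parcs G \<and> f w = c"
  shows "\<not> Digraph_Component.connected (with_proj (reconfiguration_graph k G))"
proof
  let ?R = "reconfiguration_graph k G"
  have isolated: False if h: "h \<in> colourings k G" and ex1: "\<exists>!v. v \<in> pverts G \<and> f v \<noteq> h v" for h
  proof -
    obtain v where v: "v \<in> pverts G" "f v \<noteq> h v"
      and uniq: "\<And>w. w \<in> pverts G \<Longrightarrow> f w \<noteq> h w \<Longrightarrow> w = v"
      using ex1 by blast
    have "h v \<in> {1..k}"
      using h v by (auto simp: colourings_def)
    then obtain w where w: "w \<in> pverts G" "(v, w) \<in> parcs G" "f w = h v"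
      using frozen[of v "h v"] v by auto
    moreover have "h v \<noteq> h w"
      using h w by (auto simp: colourings_def)
    ultimately have "w = v"
      by (intro uniq) auto
    with w(2,3) v(2) show False
      by simp
  qed
  assume "Digraph_Component.connected (with_proj ?R)"
  moreover have "f \<in> pverts ?R" "g \<in> pverts ?R"
    using f g by (simp_all add: reconfiguration_graph_def)
  \<comment> \<open>Connectedness is reachability in the symmetric closure, so the first arc of a
    path from \<open>f\<close> may come from either direction.\<close>
  ultimately have "f \<rightarrow>\<^sup>*\<^bsub>with_proj (mk_symmetric (with_proj ?R))\<^esub> g"
    by (simp add: Digraph_Component.connected_def strongly_connected_def mk_symmetric_def)
  then obtain h where "(f, h) \<in> parcs (mk_symmetric (with_proj ?R))"
    using \<open>f \<noteq> g\<close> by (cases rule: pre_digraph.converse_reachable_cases) auto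
  then have "(f, h) \<in> parcs ?R \<or> (h, f) \<in> parcs ?R"
    by (auto simp: mk_symmetric_def)
  moreover have "h v = f v \<longleftrightarrow> f v = h v" for v
    by (rule eq_commute)
  ultimately have "h \<in> colourings k G \<and> (\<exists>!v. v \<in> pverts G \<and> f v \<noteq> h v)"
    by (simp add: reconfiguration_graph_def) blast
  then show False
    using isolated by blast
qed

section \<open>The witness graph\<close>

text \<open>Vertex \<open>2 * i\<close> stands for \<open>c\<^sub>i\<close> and \<open>2 * i + 1\<close> for \<open>a\<^sub>i\<close>.\<close>

definition witness_graph :: "nat \<Rightarrow> nat pair_pre_digraph" where
  "witness_graph k = \<lparr> pverts = {..2 * k + 1},
     parcs = {(u, v). u \<le> 2 * k + 1 \<and> v \<le> 2 * k + 1 \<and>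
       (if even u \<and> even v then u div 4 \<noteq> v div 4
        else (even u \<or> even v) \<and> u div 2 \<noteq> v div 2)} \<rparr>"

lemma pair_graph_witness_graph: "pair_graph (witness_graph k)"
proof -
  have "finite (parcs (witness_graph k))"
    by (rule finite_subset[of _ "{..2 * k + 1} \<times> {..2 * k + 1}"]) (auto simp: witness_graph_def)
  moreover have "sym (parcs (witness_graph k))"
    by (rule symI) (auto simp: witness_graph_def split: if_splits)
  ultimately show ?thesis
    by unfold_locales (auto simp: witness_graph_def symmetric_def split: if_splits)
qed

lemma parcs_witness_graph_iff:
  assumes "u \<in> pverts (witness_graph k)" "v \<in> pverts (witness_graph k)"
  shows "(u, v) \<in> parcs (witness_graph k) \<longleftrightarrow>
    (if even u \<and> even v then u div 4 \<noteq> v div 4 else (even u \<or> even v) \<and> u div 2 \<noteq> v div 2)"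
  using assms by (simp add: witness_graph_def)

text \<open>A block is a matched pair with its two \<open>a\<close>'s: its elements in order are
  \<open>c\<^sub>i\<close>, \<open>a\<^sub>i\<close>, \<open>c\<^sub>j\<close>,
  \<open>a\<^sub>j\<close> with \<open>i = 2 * q\<close> and \<open>j = i + 1\<close>.\<close>

lemma block_eq: "{v :: nat. v div 4 = q} = {4 * q, 4 * q + 1, 4 * q + 2, 4 * q + 3}"
  by auto

lemma card_block: "card {v :: nat. v div 4 = q} = 4"
  unfolding block_eq by simp

section \<open>Absence of holes and antiholes\<close>

lemma no_hole_witness_graph: "\<not> is_hole H (witness_graph k)"
proof
  assume hole: "is_hole H (witness_graph k)"
  define S where "S = pverts H"
  define N where "N u = {w \<in> S. (u, w) \<in> parcs (witness_graph k)}" for u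
  have sub: "S \<subseteq> pverts (witness_graph k)" and five: "5 \<le> card S"
    and N2: "\<And>u. u \<in> S \<Longrightarrow> card (N u) = 2"
    using is_hole_two_regular[OF hole] by (simp_all add: S_def N_def)
  have fin: "finite S"
    using five by (metis card.infinite not_numeral_le_zero)
  have adj: "w \<in> N u \<longleftrightarrow> w \<in> S \<and>
      (if even u \<and> even w then u div 4 \<noteq> w div 4 else (even u \<or> even w) \<and> u div 2 \<noteq> w div 2)"
    if "u \<in> S" for u w
    using that parcs_witness_graph_iff[OF subsetD[OF sub] subsetD[OF sub], of u w]
    by (auto simp: N_def)
  \<comment> \<open>Every vertex not adjacent to \<open>u\<close>, including \<open>u\<close>
    itself, lies in \<open>?B\<close>. So \<open>card S\<close> is at most 2 + 3, and having at
    least 5 vertices forces equality.\<close>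
  have near: "card S = 5 \<and> {4 * (u div 4), 4 * (u div 4) + 2, u + 1} \<subseteq> S"
    if u: "u \<in> S" "even u" for u
  proof -
    let ?B = "{4 * (u div 4), 4 * (u div 4) + 2, u + 1}"
    have "w \<in> N u \<union> ?B" if "w \<in> S" for w
    proof (rule ccontr)
      assume "w \<notin> N u \<union> ?B"
      with adj[OF u(1), of w] that u show False
        by (auto split: if_splits; presburger)
    qed
    then have S: "S \<subseteq> N u \<union> (?B \<inter> S)" by auto
    have "card S \<le> card (N u \<union> (?B \<inter> S))"
      using S fin by (intro card_mono) (auto simp: N_def)
    also have "\<dots> \<le> 2 + card (?B \<inter> S)"
      using card_Un_le[of "N u" "?B \<inter> S"] N2[OF u(1)] by simp
    finally have le: "card S \<le> 2 + card (?B \<inter> S)" .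
    have "card ?B \<le> 3"
      by (simp add: card_insert_if)
    moreover have "card (?B \<inter> S) \<le> card ?B"
      by (intro card_mono) auto
    ultimately have "card S = 5" "card (?B \<inter> S) = card ?B"
      using le five by linarith+
    moreover from this(2) have "?B \<inter> S = ?B"
      by (intro card_subset_eq) auto
    ultimately show ?thesis by blast
  qed
  \<comment> \<open>Applying \<open>near\<close> to both \<open>c\<close>'s of the block also brings
    in both \<open>a\<close>'s.\<close>
  have block: "{v. v div 4 = u div 4} \<subseteq> S" if u: "u \<in> S" "even u" for u
  proof -
    have "4 * (u div 4) \<in> S" "4 * (u div 4) + 2 \<in> S"
      using near[OF u] by auto
    then show ?thesis
      using near[of "4 * (u div 4)"] near[of "4 * (u div 4) + 2"]
      by (auto simp: block_eq numeral_3_eq_3)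
  qed
  have "S \<noteq> {}"
    using five by auto
  then obtain s where s: "s \<in> S" by blast
  have "\<exists>u \<in> S. even u"
  proof (rule ccontr)
    assume "\<not> ?thesis"
    then have "N s = {}"
      using adj[OF s] s by auto
    with N2[OF s] show False by simp
  qed
  then obtain u where u: "u \<in> S" "even u" by blast
  define a where "a = 4 * (u div 4) + 1"
  have a: "a \<in> S"
    using block[OF u] by (auto simp: a_def)
  \<comment> \<open>Within its block \<open>a\<close> is adjacent only to \<open>a + 1\<close>, so
    its second neighbour is a \<open>c\<close> of another block. That block lies in \<open>S\<close>
    too, giving 8 vertices instead of 5.\<close>
  have "\<not> N a \<subseteq> {a + 1}"
    using N2[OF a] card_mono[of "{a + 1}" "N a"] by auto
  then obtain x where x: "x \<in> N a" "x \<noteq> a + 1" by blast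
  have x': "x \<in> S" "even x" "x div 4 \<noteq> u div 4"
    using x adj[OF a, of x] by (auto simp: a_def split: if_splits; presburger)+
  have "card ({v. v div 4 = u div 4} \<union> {v. v div 4 = x div 4}) = 8"
    using x'(3) by (subst card_Un_disjoint) (auto simp: card_block intro: card_ge_0_finite)
  moreover have "{v. v div 4 = u div 4} \<union> {v. v div 4 = x div 4} \<subseteq> S"
    using block[OF u] block[OF x'(1,2)] by blast
  ultimately have "8 \<le> card S"
    using fin card_mono by metis
  then show False
    using near[OF u] by simp
qed

lemma no_antihole_witness_graph: "\<not> is_antihole H (witness_graph k)"
proof
  assume antihole: "is_antihole H (witness_graph k)"
  define S where "S = pverts H"
  define M where "M u = {w \<in> S. w \<noteq> u \<and> (u, w) \<notin> parcs (witness_graph k)}" for u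
  have sub: "S \<subseteq> pverts (witness_graph k)" and five: "5 \<le> card S"
    and M2: "\<And>u. u \<in> S \<Longrightarrow> card (M u) = 2"
    using is_antihole_two_regular[OF antihole] by (simp_all add: S_def M_def)
  have fin: "finite S"
    using five by (metis card.infinite not_numeral_le_zero)
  have nonadj: "w \<in> M u \<longleftrightarrow> w \<in> S \<and> w \<noteq> u \<and>
      (if even u \<and> even w then u div 4 = w div 4 else (odd u \<and> odd w) \<or> u div 2 = w div 2)"
    if "u \<in> S" for u w
    using that parcs_witness_graph_iff[OF subsetD[OF sub] subsetD[OF sub], of u w]
    by (auto simp: M_def)
  have near: "{4 * (u div 4), 4 * (u div 4) + 2, u + 1} \<subseteq> S" if u: "u \<in> S" "even u" for u
  proof -
    let ?B = "{4 * (u div 4), 4 * (u div 4) + 2, u + 1} - {u}"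
    have M: "M u \<subseteq> ?B"
    proof
      fix w assume "w \<in> M u"
      with nonadj[OF u(1), of w] u show "w \<in> ?B"
        by (auto split: if_splits; presburger)
    qed
    have "u = 4 * (u div 4) \<or> u = 4 * (u div 4) + 2"
      using u(2) by presburger
    then obtain q where "u = 4 * q \<or> u = 4 * q + 2"
      by blast
    then have "card ?B = 2"
      by (auto simp: card_insert_if insert_Diff_if)
    \<comment> \<open>Both sets have two elements, so both non-neighbours of \<open>u\<close> lie in
      \<open>S\<close>.\<close>
    with M have "M u = ?B"
      using M2[OF u(1)] by (intro card_subset_eq) auto
    moreover have "M u \<subseteq> S"
      by (auto simp: M_def)
    ultimately have "?B \<subseteq> S"
      by (rule subst)
    then have "insert u ?B \<subseteq> S"
      using u(1) by (rule insert_subsetI[rotated])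
    then show ?thesis
      by (simp only: insert_Diff_single insert_subset)
  qed
  have block: "{v. v div 4 = u div 4} \<subseteq> S" if u: "u \<in> S" "even u" for u
  proof -
    have "4 * (u div 4) \<in> S" "4 * (u div 4) + 2 \<in> S"
      using near[OF u] by auto
    then show ?thesis
      using near[of "4 * (u div 4)"] near[of "4 * (u div 4) + 2"]
      by (auto simp: block_eq numeral_3_eq_3)
  qed
  have "S \<noteq> {}"
    using five by auto
  then obtain s where s: "s \<in> S" by blast
  have "\<exists>u \<in> S. even u"
  proof (rule ccontr)
    assume "\<not> ?thesis"
    \<comment> \<open>The \<open>a\<close>'s are independent, so \<open>s\<close> would have at
      least 4 non-neighbours in \<open>S\<close>.\<close>
    then have "M s = S - {s}"
      using nonadj[OF s] s by auto
    with M2[OF s] five s fin show False by simp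
  qed
  then obtain u where u: "u \<in> S" "even u" by blast
  define a where "a = 4 * (u div 4) + 1"
  have a: "a \<in> S" "a - 1 \<in> S" "a + 2 \<in> S"
    using block[OF u] by (auto simp: a_def)
  have "{a - 1, a + 2} \<subseteq> M a"
    using a nonadj[OF a(1)] by (auto simp: a_def)
  moreover have "card {a - 1, a + 2} = 2"
    by (simp add: a_def)
  moreover have "finite (M a)"
    using fin by (simp add: M_def)
  ultimately have Ma: "M a = {a - 1, a + 2}"
    using M2[OF a(1)] by (metis card_subset_eq)
  \<comment> \<open>Any other \<open>a\<close> in \<open>S\<close> is a non-neighbour of
    \<open>a\<close>, hence equals \<open>a + 2\<close>, in the same block.\<close>
  have odd_S: "x div 4 = u div 4" if "x \<in> S" "odd x" for x
    using that Ma nonadj[OF a(1), of x] by (cases "x = a") (auto simp: a_def)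
  have "S \<subseteq> {v. v div 4 = u div 4}"
  proof
    fix x assume x: "x \<in> S"
    show "x \<in> {v. v div 4 = u div 4}"
    proof (cases "even x")
      case True
      \<comment> \<open>A \<open>c\<close> in \<open>S\<close> brings along an \<open>a\<close> of
        its own block, to which \<open>odd_S\<close> applies.\<close>
      then have "4 * (x div 4) + 1 \<in> S"
        using block[OF x] by auto
      from odd_S[OF this] show ?thesis by simp
    qed (use odd_S x in auto)
  qed
  then have "card S \<le> 4"
    using card_mono[of "{v. v div 4 = u div 4}" S] by (simp add: card_block block_eq)
  then show False
    using five by simp
qed

theorem theorem1:
  fixes k :: nat
  assumes "k \<ge> 3"
  shows "\<exists>G :: nat pair_pre_digraph.
           pair_graph G \<and> colourable k G \<and> weakly_chordal G \<and>
           \<not> Digraph_Component.connected (with_proj (reconfiguration_graph (k + 1) G))"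
proof (intro exI conjI)
  let ?G = "witness_graph k"
  let ?V = "{..2 * k + 1}"
  let ?f = "restrict (\<lambda>v. v div 2 + 1) ?V"
  let ?g = "restrict (\<lambda>v. if even v then v div 4 + 2 else 1) ?V"
  show "pair_graph ?G"
    by (rule pair_graph_witness_graph)
  show "weakly_chordal ?G"
    by (simp add: weakly_chordal_def no_hole_witness_graph no_antihole_witness_graph)
  have g: "?g \<in> colourings k ?G"
    \<comment> \<open>The largest colour is \<open>k div 2 + 2\<close>, which is at most
      \<open>k\<close> because \<open>k \<ge> 3\<close>.\<close>
    using assms by (auto simp: colourings_def witness_graph_def split: if_splits)
  then show "colourable k ?G"
    by (auto simp: colourable_def)
  have f: "?f \<in> colourings (k + 1) ?G"
    by (auto simp: colourings_def witness_graph_def split: if_splits; presburger)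
  have g': "?g \<in> colourings (k + 1) ?G"
    using g by (force simp: colourings_def PiE_iff)
  have "?f \<noteq> ?g"
  proof
    assume "?f = ?g"
    \<comment> \<open>At \<open>c\<^sub>k\<close> the first colouring uses \<open>k + 1\<close>, the
      second at most \<open>k\<close>.\<close>
    then have "?f (2 * k) = ?g (2 * k)"
      by (rule fun_cong)
    then show False
      using assms by simp
  qed
  show "\<not> Digraph_Component.connected (with_proj (reconfiguration_graph (k + 1) ?G))"
  proof (rule frozen_colouring_imp_not_connected[OF f g' \<open>?f \<noteq> ?g\<close>])
    fix v c assume v: "v \<in> pverts ?G" and c: "c \<in> {1..k + 1}" "c \<noteq> ?f v"
    \<comment> \<open>\<open>w\<close> is the vertex of index \<open>c - 1\<close> and of the other
      type than \<open>v\<close>. It has colour \<open>c\<close>, and its index differs from that of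
      \<open>v\<close>, so the two are adjacent.\<close>
    define w where "w = (if even v then 2 * c - 1 else 2 * c - 2)"
    have "w \<le> 2 * k + 1" "w div 2 = c - 1" "even w \<longleftrightarrow> odd v"
      using c by (auto simp: w_def)
    with v c show "\<exists>w \<in> pverts ?G. (v, w) \<in> parcs ?G \<and> ?f w = c"
      by (intro bexI[of _ w]) (auto simp: witness_graph_def)
  qed
qed

end
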